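(* Let $\mathcal X = \mathcal X^{(1)}\times\dots\times\mathcal X^{(k)}$ be a finite product set and let $Q \subseteq \mathcal X$ be such that the graph $F_{\mathcal X, Q}$ is connected. Then for every $n\in\mathbb N$ there exists a $k$-player game $\mathcal G = (\mathcal X, \mathcal A, \mu, Q, V)$ with $\mu$ the uniform distribution on $Q$ and $|\mathcal A| = n^k\cdot|\mathcal X|^n$, such that $\mathrm{val}(\mathcal G^n) = E_Q(n)$.
   Context: $F_{\mathcal X,Q}$ is the undirected $k$-partite graph with vertex set the disjoint union $\mathcal X^{(1)}\cup\dots\cup\mathcal X^{(k)}$ and with an edge $\{x^{(i)},x^{(j)}\}$ for every $(x^{(1)},\dots,x^{(k)})\in Q$ and every $i\ne j$. A $k$-player game is a tuple $\mathcal G = (\mathcal X, \mathcal A, \mu, Q, V)$ where $\mathcal X$ and $\mathcal A = \mathcal A^{(1)}\times\dots\times\mathcal A^{(k)}$ are finite product sets, $\mu$ is a distribution on $\mathcal X$ with support $Q$, and $V:\mathcal X\times\mathcal A\to\{0,1\}$. Its value is $\mathrm{val}(\mathcal G) = \max \Pr_{X\sim\mu}[V(X, f^{(1)}(X^{(1)}),\dots,f^{(k)}(X^{(k)}))=1]$ over all functions $f^{(j)}:\mathcal X^{(j)}\to\mathcal A^{(j)}$. The $n$-fold repetition $\mathcal G^n = (\mathcal X^n, \mathcal A^n, \mu^n, Q^n, V^n)$ has player $j$ receive $x^{(j)}\in(\mathcal X^{(j)})^n$ and answer in $(\mathcal A^{(j)})^n$, distribution $\mu^n(x)=\prod_i\mu(x_i)$,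 predicate $V^n(x,a)=\prod_{i=1}^n V(x_i,a_i)$. For $x\in\mathcal X^n$, $x_i$ is the coordinate-$i$ question tuple, $x^{(j)}$ player $j$'s question vector, $x_i^{(j)}$ its $i$-th entry. Let $q=|Q|$. A set $W\subseteq Q^n$ contains a forbidden subgraph if there are $e(1),\dots,e(q)\in W$ and $i\in[n]$ such that (1) $\{e(1)_i,\dots,e(q)_i\}=Q$ and (2) for every $j\in[k]$ and $r,r'\in[q]$, $e(r)^{(j)}_i=e(r')^{(j)}_i$ implies $e(r)^{(j)}=e(r')^{(j)}$. $E_Q(n)$ is the maximum of $|W|/q^n$ over all $W\subseteq Q^n$ containing no forbidden subgraph. *)

theory Defs
  imports "HOL-Probability.Probability" "Graph_Theory.Digraph_Component"
begin

text \<open>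
  Players are indexed by \<open>{1..k}\<close> and coordinates by \<open>{1..n}\<close>. Tuples are extensional
  functions on their index set, so \<open>PiE {1..k} X\<close> is the product of the sets \<open>X j\<close>.
\<close>

text \<open>
  Vertices are tagged with their player, which makes the union of the question sets disjoint.
  The undirected graph is represented by its symmetric arc relation.
\<close>
definition question_graph ::
    "nat \<Rightarrow> (nat \<Rightarrow> 'x set) \<Rightarrow> (nat \<Rightarrow> 'x) set \<Rightarrow> (nat \<times> 'x) pair_pre_digraph" where
  "question_graph k X Q =
     \<lparr> pverts = (SIGMA j:{1..k}. X j),
       parcs = {((i, x i), (j, x j)) | x i j. x \<in> Q \<and> i \<in> {1..k} \<and> j \<in> {1..k} \<and> i \<noteq> j} \<rparr>"

record ('x, 'a) game =
  questions :: "nat \<Rightarrow> 'x set"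
  answers :: "nat \<Rightarrow> 'a set"
  question_dist :: "(nat \<Rightarrow> 'x) pmf"
  question_supp :: "(nat \<Rightarrow> 'x) set"
  verdict :: "(nat \<Rightarrow> 'x) \<Rightarrow> (nat \<Rightarrow> 'a) \<Rightarrow> bool"

definition is_game :: "nat \<Rightarrow> ('x, 'a) game \<Rightarrow> bool" where
  "is_game k G \<longleftrightarrow>
     (\<forall>j\<in>{1..k}. finite (questions G j) \<and> finite (answers G j)) \<and>
     question_supp G \<subseteq> PiE {1..k} (questions G) \<and>
     set_pmf (question_dist G) = question_supp G"

definition game_value :: "nat \<Rightarrow> ('x, 'a) game \<Rightarrow> real" where
  "game_value k G =
     Max ((\<lambda>f. measure_pmf.prob (question_dist G)
                 {x. verdict G x (\<lambda>j\<in>{1..k}. f j (x j))}) `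
          (\<Pi>\<^sub>E j\<in>{1..k}. questions G j \<rightarrow>\<^sub>E answers G j))"

definition player_vec :: "nat \<Rightarrow> (nat \<Rightarrow> nat \<Rightarrow> 'x) \<Rightarrow> nat \<Rightarrow> nat \<Rightarrow> 'x" where
  "player_vec n x j = (\<lambda>i\<in>{1..n}. x i j)"

text \<open>
  An element of the \<open>n\<close>-th power of a product set is an \<open>n\<close>-vector of \<open>k\<close>-tuples \<open>x i j\<close>;
  an input of the repeated game is a \<open>k\<close>-tuple of \<open>n\<close>-vectors \<open>y j i\<close>.
  \<open>to_players\<close> turns the first form into the second, and \<open>coord\<close> extracts the
  \<open>k\<close>-tuple at coordinate \<open>i\<close> from the second form.
\<close>
definition to_players :: "nat \<Rightarrow> nat \<Rightarrow> (nat \<Rightarrow> nat \<Rightarrow> 'x) \<Rightarrow> nat \<Rightarrow> nat \<Rightarrow> 'x" where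
  "to_players k n x = (\<lambda>j\<in>{1..k}. player_vec n x j)"

definition coord :: "nat \<Rightarrow> (nat \<Rightarrow> nat \<Rightarrow> 'x) \<Rightarrow> nat \<Rightarrow> nat \<Rightarrow> 'x" where
  "coord k y i = (\<lambda>j\<in>{1..k}. y j i)"

definition repeated_game ::
    "nat \<Rightarrow> nat \<Rightarrow> ('x, 'a) game \<Rightarrow> (nat \<Rightarrow> 'x, nat \<Rightarrow> 'a) game" where
  "repeated_game k n G =
     \<lparr> questions = (\<lambda>j. {1..n} \<rightarrow>\<^sub>E questions G j),
       answers = (\<lambda>j. {1..n} \<rightarrow>\<^sub>E answers G j),
       question_dist =
         map_pmf (to_players k n) (Pi_pmf {1..n} undefined (\<lambda>_. question_dist G)),
       question_supp = to_players k n ` ({1..n} \<rightarrow>\<^sub>E question_supp G),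
       verdict = (\<lambda>y a. \<forall>i\<in>{1..n}. verdict G (coord k y i) (coord k a i)) \<rparr>"

definition contains_forbidden_subgraph ::
    "nat \<Rightarrow> nat \<Rightarrow> (nat \<Rightarrow> 'x) set \<Rightarrow> (nat \<Rightarrow> nat \<Rightarrow> 'x) set \<Rightarrow> bool" where
  "contains_forbidden_subgraph k n Q W \<longleftrightarrow>
     (\<exists>e. (\<forall>r\<in>{1..card Q}. e r \<in> W) \<and>
       (\<exists>i\<in>{1..n}.
          {e r i | r. r \<in> {1..card Q}} = Q \<and>
          (\<forall>j\<in>{1..k}. \<forall>r\<in>{1..card Q}. \<forall>r'\<in>{1..card Q}.
             e r i j = e r' i j \<longrightarrow> player_vec n (e r) j = player_vec n (e r') j)))"

definition extremal_density :: "nat \<Rightarrow> (nat \<Rightarrow> 'x) set \<Rightarrow> nat \<Rightarrow> real" where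
  "extremal_density k Q n =
     Max {real (card W) / real (card Q) ^ n | W.
            W \<subseteq> ({1..n} \<rightarrow>\<^sub>E Q) \<and> \<not> contains_forbidden_subgraph k n Q W}"

lemma coord_to_players:
  assumes "x \<in> {1..n} \<rightarrow>\<^sub>E PiE {1..k} X" "i \<in> {1..n}"
  shows "coord k (to_players k n x) i = x i"
proof -
  have "x i \<in> PiE {1..k} X"
    by (rule PiE_mem[OF assms])
  then have "x i j = undefined" if "j \<notin> {1..k}" for j
    using that by (rule PiE_arb)
  then show ?thesis
    using assms(2) by (simp add: coord_def to_players_def player_vec_def fun_eq_iff restrict_def)
qed

lemma inj_on_to_players:
  "inj_on (to_players k n) ({1..n} \<rightarrow>\<^sub>E PiE {1..k} X)"
proof (rule inj_onI)
  fix x y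
  assume *: "x \<in> {1..n} \<rightarrow>\<^sub>E PiE {1..k} X" "y \<in> {1..n} \<rightarrow>\<^sub>E PiE {1..k} X"
    "to_players k n x = to_players k n y"
  show "x = y"
  proof (rule PiE_ext[OF *(1,2)])
    fix i assume i: "i \<in> {1..n}"
    show "x i = y i"
      using coord_to_players[OF *(1) i] coord_to_players[OF *(2) i] *(3) by simp
  qed
qed

lemma set_Pi_pmf_undefined:
  "finite I \<Longrightarrow> set_pmf (Pi_pmf I undefined (\<lambda>_. p)) = (I \<rightarrow>\<^sub>E set_pmf p)"
  by (auto simp: set_Pi_pmf PiE_dflt_def PiE_iff extensional_def)

lemma is_game_repeated:
  assumes "is_game k G"
  shows "is_game k (repeated_game k n G)"
proof -
  have "to_players k n x \<in> (\<Pi>\<^sub>E j\<in>{1..k}. {1..n} \<rightarrow>\<^sub>E questions G j)"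
    if "x \<in> {1..n} \<rightarrow>\<^sub>E question_supp G" for x
  proof -
    have "x i j \<in> questions G j" if "i \<in> {1..n}" "j \<in> {1..k}" for i j
    proof -
      have "x i \<in> question_supp G"
        by (rule PiE_mem[OF \<open>x \<in> _\<close> that(1)])
      then have "x i \<in> PiE {1..k} (questions G)"
        using assms unfolding is_game_def by (meson subsetD)
      then show ?thesis
        using that(2) by (rule PiE_mem)
    qed
    then show ?thesis
      unfolding to_players_def player_vec_def by (intro restrict_PiE_iff[THEN iffD2] ballI) simp
  qed
  then show ?thesis
    using assms
    by (simp add: is_game_def repeated_game_def set_Pi_pmf_undefined finite_PiE image_subset_iff)
qed

lemma pmf_repeated_game:
  assumes "is_game k G" "x \<in> {1..n} \<rightarrow>\<^sub>E question_supp G"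
  shows "pmf (question_dist (repeated_game k n G)) (to_players k n x) =
    (\<Prod>i\<in>{1..n}. pmf (question_dist G) (x i))"
proof -
  have sub: "({1..n} \<rightarrow>\<^sub>E question_supp G) \<subseteq> ({1..n} \<rightarrow>\<^sub>E PiE {1..k} (questions G))"
    using assms(1) by (intro PiE_mono) (auto simp: is_game_def)
  have "inj_on (to_players k n) (set_pmf (Pi_pmf {1..n} undefined (\<lambda>_. question_dist G)))"
    using assms(1) inj_on_subset[OF inj_on_to_players sub]
    by (simp add: set_Pi_pmf_undefined is_game_def)
  moreover have "x \<in> set_pmf (Pi_pmf {1..n} undefined (\<lambda>_. question_dist G))"
    using assms by (simp add: set_Pi_pmf_undefined is_game_def)
  ultimately have "pmf (question_dist (repeated_game k n G)) (to_players k n x) =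
      pmf (Pi_pmf {1..n} undefined (\<lambda>_. question_dist G)) x"
    by (simp add: repeated_game_def pmf_map_inj)
  also have "\<dots> = (\<Prod>i\<in>{1..n}. pmf (question_dist G) (x i))"
    using assms(2) by (intro pmf_Pi') (auto simp: PiE_def extensional_def)
  finally show ?thesis .
qed

end

theory Submission
  imports Defs
begin

text \<open>
  Fix an extremal \<open>W\<close> without forbidden subgraph and let an answer of player \<open>j\<close> be a coordinate
  together with a vector of \<open>n\<close> questions to \<open>j\<close>. The verifier accepts on question \<open>x\<close> if all
  players name the same coordinate \<open>i\<close> and their vectors form a \<open>w \<in> W\<close> with \<open>w i = x\<close>. In the
  repeated game, answering \<open>(i, own question vector)\<close> at each coordinate \<open>i\<close> wins on all of \<open>W\<close>.
  Conversely, suppose that the winning set of some strategy contained a forbidden subgraph at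
  coordinate \<open>i\<close>. Its elements are answered at \<open>i\<close> by elements of \<open>W\<close>, and whenever two of them
  agree for some player at \<open>i\<close>, that player sees the same vector and answers the same. Connectedness
  then forces all answers to name one coordinate, where the answers form a forbidden subgraph in \<open>W\<close>.
\<close>

text \<open>Connectedness is strong connectedness of the symmetric closure, so a path may traverse
  an arc backwards; hence the equivalence required of \<open>P\<close> along arcs. The proof is
  induction along such a path.\<close>

lemma connected_invariant:
  assumes "Digraph_Component.connected G" "u \<in> verts G" "v \<in> verts G"
    and "P u"
    and "\<And>a b. (a, b) \<in> arcs_ends G \<Longrightarrow> P a \<longleftrightarrow> P b"
  shows "P v"
proof -
  have "u \<rightarrow>\<^sup>*\<^bsub>with_proj (mk_symmetric G)\<^esub> v"
    using assms(1-3) by (auto simp: Digraph_Component.connected_def strongly_connected_def)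
  then show ?thesis
    using assms(4) unfolding reachable_def
  proof (induction rule: rtrancl_on_induct)
    case base
    then show ?case by simp
  next
    case (step a b)
    then have "(a, b) \<in> arcs_ends G \<or> (b, a) \<in> arcs_ends G"
      by (auto simp: mk_symmetric_def arcs_ends_def arc_to_ends_def)
    with step assms(5) show ?case by blast
  qed
qed

text \<open>An edge joins two entries of one tuple \<open>g t\<close>, so every index whose tuple
  passes through either endpoint has the value \<open>c t\<close>. Connectedness spreads this value
  to all indices. Here \<open>c\<close> will be the coordinate named by the answers.\<close>

lemma question_graph_connected_constant:
  assumes conn: "Digraph_Component.connected (with_proj (question_graph k X Q))"
    and Q: "Q \<subseteq> PiE {1..k} X" "g ` I = Q"
    and c: "\<And>r s j. r \<in> I \<Longrightarrow> s \<in> I \<Longrightarrow> j \<in> {1..k} \<Longrightarrow> g r j = g s j \<Longrightarrow> c r = c s"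
    and rs: "r \<in> I" "s \<in> I"
  shows "c r = c s"
proof -
  let ?G = "question_graph k X Q"
  define P where "P = (\<lambda>(j, y). \<forall>s\<in>I. g s j = y \<longrightarrow> c s = c r)"
  \<comment> \<open>Connectedness includes having a vertex, which yields a player \<open>j\<close>
    through whom all tuples can be located in the graph.\<close>
  have "verts (with_proj ?G) \<noteq> {}"
    using conn by (auto simp: Digraph_Component.connected_def strongly_connected_def)
  then obtain j where j: "j \<in> {1..k}"
    unfolding question_graph_def by fastforce
  have mem: "(j, g s j) \<in> verts (with_proj ?G)" if "s \<in> I" for s
  proof -
    have "g s \<in> PiE {1..k} X" using that Q by blast
    then have "g s j \<in> X j" using j by (rule PiE_mem)
    then show ?thesis using j by (simp add: question_graph_def)
  qed
  have imp: "P b" if ab: "(a, b) \<in> arcs_ends (with_proj ?G)" and "P a" for a b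
  proof -
    obtain x i i' where x: "x \<in> Q" "i \<in> {1..k}" "i' \<in> {1..k}" "a = (i, x i)" "b = (i', x i')"
      using ab by (auto simp: question_graph_def arcs_ends_def arc_to_ends_def)
    obtain t where t: "t \<in> I" "g t = x" using x(1) Q(2) by blast
    then have "c t = c r" using \<open>P a\<close> x by (auto simp: P_def)
    then show ?thesis using c[OF _ t(1) x(3)] t(2) x by (auto simp: P_def)
  qed
  have sym: "(b, a) \<in> arcs_ends (with_proj ?G)" if "(a, b) \<in> arcs_ends (with_proj ?G)" for a b
    using that by (auto simp: question_graph_def arcs_ends_def arc_to_ends_def)
  have "P (j, g r j)"
    using c[OF _ rs(1) j] by (auto simp: P_def)
  with conn mem[OF rs(1)] mem[OF rs(2)] have "P (j, g s j)"
    by (rule connected_invariant) (use imp sym in blast)+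
  then show ?thesis
    using rs(2) by (simp add: P_def)
qed

lemma Pi_pmf_pmf_of_set_undefined:
  assumes "finite I" "finite A" "A \<noteq> {}"
  shows "Pi_pmf I undefined (\<lambda>_. pmf_of_set A) = pmf_of_set (I \<rightarrow>\<^sub>E A)"
proof -
  have "PiE_dflt I undefined (\<lambda>_. A) = (I \<rightarrow>\<^sub>E A)"
    by (auto simp: PiE_dflt_def PiE_iff extensional_def)
  with assms show ?thesis
    by (simp add: Pi_pmf_of_set)
qed

text \<open>A power of a uniform distribution is uniform, so winning probabilities are densities
  with the same normalization as in \<open>extremal_density\<close>.\<close>

lemma prob_repeated_game_uniform:
  assumes "question_dist G = pmf_of_set Q" "finite Q" "Q \<noteq> {}"
  shows "measure_pmf.prob (question_dist (repeated_game k n G)) A =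
    card {x \<in> {1..n} \<rightarrow>\<^sub>E Q. to_players k n x \<in> A} / real (card Q) ^ n"
proof -
  have "({1..n} \<rightarrow>\<^sub>E Q) \<inter> to_players k n -` A = {x \<in> {1..n} \<rightarrow>\<^sub>E Q. to_players k n x \<in> A}"
    by blast
  then show ?thesis
    using assms
    by (simp add: repeated_game_def Pi_pmf_pmf_of_set_undefined measure_pmf_of_set finite_PiE
        PiE_eq_empty_iff card_PiE)
qed

text \<open>Ensures that the maximum defining \<open>extremal_density\<close> ranges over a nonempty
  family.\<close>

lemma not_contains_forbidden_empty:
  assumes "finite Q" "Q \<noteq> {}"
  shows "\<not> contains_forbidden_subgraph k n Q {}"
proof -
  have "1 \<in> {1..card Q}" using assms by (simp add: Suc_le_eq card_gt_0_iff)
  then show ?thesis by (auto simp: contains_forbidden_subgraph_def)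
qed

lemma finite_densities:
  assumes "finite Q"
  shows "finite {real (card W) / real (card Q) ^ n | W.
            W \<subseteq> ({1..n} \<rightarrow>\<^sub>E Q) \<and> \<not> contains_forbidden_subgraph k n Q W}"
proof (rule finite_subset)
  show "finite ((\<lambda>W. real (card W) / real (card Q) ^ n) ` Pow ({1..n} \<rightarrow>\<^sub>E Q))"
    using assms by (simp add: finite_PiE)
qed auto

lemma extremal_density_upper:
  assumes "finite Q" "W \<subseteq> ({1..n} \<rightarrow>\<^sub>E Q)" "\<not> contains_forbidden_subgraph k n Q W"
  shows "card W / real (card Q) ^ n \<le> extremal_density k Q n"
  unfolding extremal_density_def using assms by (intro Max_ge finite_densities) auto

lemma extremal_density_attained:
  assumes "finite Q" "Q \<noteq> {}"
  obtains W where "W \<subseteq> ({1..n} \<rightarrow>\<^sub>E Q)" "\<not> contains_forbidden_subgraph k n Q W"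
    "extremal_density k Q n = card W / real (card Q) ^ n"
proof -
  have "extremal_density k Q n \<in> {real (card W) / real (card Q) ^ n | W.
            W \<subseteq> ({1..n} \<rightarrow>\<^sub>E Q) \<and> \<not> contains_forbidden_subgraph k n Q W}"
    unfolding extremal_density_def
    using not_contains_forbidden_empty[OF assms] by (intro Max_in finite_densities[OF assms(1)]) blast
  then show ?thesis using that by auto
qed

text \<open>The map \<open>d j\<close> decodes an answer of player \<open>j\<close> into a coordinate and a question vector.\<close>
definition embedding_verdict ::
    "nat \<Rightarrow> nat \<Rightarrow> (nat \<Rightarrow> nat \<Rightarrow> 'x) set \<Rightarrow> (nat \<Rightarrow> 'a \<Rightarrow> nat \<times> (nat \<Rightarrow> 'x)) \<Rightarrow>
     (nat \<Rightarrow> 'x) \<Rightarrow> (nat \<Rightarrow> 'a) \<Rightarrow> bool" where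
  "embedding_verdict k n W d x a \<longleftrightarrow>
     (\<exists>i\<in>{1..n}. \<exists>w\<in>W. w i = x \<and> (\<forall>j\<in>{1..k}. d j (a j) = (i, player_vec n w j)))"

lemma embedding_game_winning_set_not_forbidden:
  assumes conn: "Digraph_Component.connected (with_proj (question_graph k X Q))"
    and Q: "Q \<subseteq> PiE {1..k} X"
    and W: "\<not> contains_forbidden_subgraph k n Q W"
    and W': "\<And>x i. x \<in> W' \<Longrightarrow> i \<in> {1..n} \<Longrightarrow>
       embedding_verdict k n W d (x i) (\<lambda>j\<in>{1..k}. f j (player_vec n x j) i)"
  shows "\<not> contains_forbidden_subgraph k n Q W'"
proof
  let ?I = "{1..card Q}"
  assume "contains_forbidden_subgraph k n Q W'"
  then obtain e i where e: "\<forall>r\<in>?I. e r \<in> W'" and i: "i \<in> {1..n}"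
    and eQ: "{e r i | r. r \<in> ?I} = Q"
    and e_det: "\<forall>j\<in>{1..k}. \<forall>r\<in>?I. \<forall>s\<in>?I. e r i j = e s i j \<longrightarrow>
      player_vec n (e r) j = player_vec n (e s) j"
    unfolding contains_forbidden_subgraph_def by (elim exE conjE bexE)
  have "\<forall>r\<in>?I. \<exists>t w. t \<in> {1..n} \<and> w \<in> W \<and> w t = e r i \<and>
      (\<forall>j\<in>{1..k}. d j (f j (player_vec n (e r) j) i) = (t, player_vec n w j))"
    using W'[OF bspec[OF e] i] unfolding embedding_verdict_def by fastforce
  then obtain t w where tw: "\<And>r. r \<in> ?I \<Longrightarrow> t r \<in> {1..n}" "\<And>r. r \<in> ?I \<Longrightarrow> w r \<in> W"
      "\<And>r. r \<in> ?I \<Longrightarrow> w r (t r) = e r i"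
      "\<And>r j. r \<in> ?I \<Longrightarrow> j \<in> {1..k} \<Longrightarrow>
         d j (f j (player_vec n (e r) j) i) = (t r, player_vec n (w r) j)"
    by metis
  \<comment> \<open>Equal questions at \<open>i\<close> force equal question vectors by
    \<open>e_det\<close>, hence equal answers at \<open>i\<close>, hence equal decoded
    pairs.\<close>
  have same: "t r = t s \<and> player_vec n (w r) j = player_vec n (w s) j"
    if "j \<in> {1..k}" "r \<in> ?I" "s \<in> ?I" "e r i j = e s i j" for j r s
    using tw(4)[OF that(2,1)] tw(4)[OF that(3,1)] e_det that
    by (metis prod.inject)
  have eQ': "(\<lambda>r. e r i) ` ?I = Q" using eQ by blast
  have t_const: "t r = t s" if "r \<in> ?I" "s \<in> ?I" for r s
    by (rule question_graph_connected_constant[OF conn Q eQ' _ that]) (use same in blast)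
  \<comment> \<open>For empty \<open>Q\<close> there are no indices \<open>r\<close>, so the
    coordinate \<open>i\<close> alone would make every \<open>W\<close> contain a forbidden
    subgraph.\<close>
  have "Q \<noteq> {}"
    using W i by (auto simp: contains_forbidden_subgraph_def)
  then obtain r0 where r0: "r0 \<in> ?I" using eQ by blast
  \<comment> \<open>At the common coordinate \<open>t r0\<close> the vectors \<open>w r\<close>
    repeat the tuples \<open>e r i\<close>, so both defining conditions carry over from
    \<open>e\<close> to \<open>w\<close>.\<close>
  have wt: "w r (t r0) = e r i" if "r \<in> ?I" for r
    using tw(3)[OF that] t_const[OF that r0] by simp
  have "(\<lambda>r. w r (t r0)) ` ?I = (\<lambda>r. e r i) ` ?I"
    by (rule image_cong[OF refl]) (rule wt)
  then have img: "{w r (t r0) | r. r \<in> ?I} = Q"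
    unfolding eQ' by blast
  have det: "\<forall>j\<in>{1..k}. \<forall>r\<in>?I. \<forall>s\<in>?I. w r (t r0) j = w s (t r0) j \<longrightarrow>
      player_vec n (w r) j = player_vec n (w s) j"
  proof (intro ballI impI)
    fix j r s assume jrs: "j \<in> {1..k}" "r \<in> ?I" "s \<in> ?I" "w r (t r0) j = w s (t r0) j"
    then have "e r i j = e s i j" by (simp only: wt)
    with same jrs(1-3) show "player_vec n (w r) j = player_vec n (w s) j" by blast
  qed
  have "contains_forbidden_subgraph k n Q W"
    unfolding contains_forbidden_subgraph_def
    by (intro exI[of _ w] conjI bexI[of _ "t r0"] ballI tw(1)[OF r0] img det) (rule tw(2))
  with W show False ..
qed

theorem theorem3p6:
  fixes k :: nat and X :: "nat \<Rightarrow> 'x set" and Q :: "(nat \<Rightarrow> 'x) set"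
  assumes "\<And>j. j \<in> {1..k} \<Longrightarrow> finite (X j)"
    and "Q \<subseteq> PiE {1..k} X"
    and "Q \<noteq> {}"
    and "Digraph_Component.connected (with_proj (question_graph k X Q))"
  shows "\<forall>n :: nat. \<exists>G :: ('x, nat) game.
    is_game k G \<and>
    questions G = X \<and>
    question_supp G = Q \<and>
    question_dist G = pmf_of_set Q \<and>
    card (PiE {1..k} (answers G)) = n ^ k * card (PiE {1..k} X) ^ n \<and>
    game_value k (repeated_game k n G) = extremal_density k Q n"
proof
  fix n :: nat
  have finQ: "finite Q"
    using assms(1,2) by (meson finite_PiE finite_atLeastAtMost finite_subset)
  obtain W where W: "W \<subseteq> ({1..n} \<rightarrow>\<^sub>E Q)" "\<not> contains_forbidden_subgraph k n Q W"
    "extremal_density k Q n = card W / real (card Q) ^ n"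
    using extremal_density_attained[OF finQ assms(3)] .
  \<comment> \<open>These pairs are the intended answers; there are n * |X j|^n of them for player
    \<open>j\<close>. They are coded by an initial segment of the naturals, the answer type being
    \<open>nat\<close>, and \<open>d j\<close> decodes.\<close>
  let ?B = "\<lambda>j. {1..n} \<times> ({1..n} \<rightarrow>\<^sub>E X j)"
  have finB: "finite (?B j)" if "j \<in> {1..k}" for j
    using assms(1)[OF that] by (simp add: finite_PiE)
  have "\<exists>d. bij_betw d {0..<card (?B j)} (?B j)" if "j \<in> {1..k}" for j
    using ex_bij_betw_nat_finite[OF finB[OF that]] .
  then obtain d where d: "\<And>j. j \<in> {1..k} \<Longrightarrow> bij_betw (d j) {0..<card (?B j)} (?B j)"
    by metis
  define G :: "('x, nat) game" where "G = \<lparr> questions = X, answers = (\<lambda>j. {0..<card (?B j)}),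
      question_dist = pmf_of_set Q, question_supp = Q, verdict = embedding_verdict k n W d \<rparr>"
  have game: "is_game k G"
    using assms(1-3) finQ by (auto simp: is_game_def G_def)
  have card_answers: "card (PiE {1..k} (answers G)) = n ^ k * card (PiE {1..k} X) ^ n"
    by (simp add: G_def card_PiE card_cartesian_product prod.distrib prod_power_distrib)
  let ?R = "repeated_game k n G"
  let ?S = "\<Pi>\<^sub>E j\<in>{1..k}. questions ?R j \<rightarrow>\<^sub>E answers ?R j"
  let ?win = "\<lambda>f x. \<forall>i\<in>{1..n}.
    embedding_verdict k n W d (x i) (\<lambda>j\<in>{1..k}. f j (player_vec n x j) i)"
  \<comment> \<open>Rewrites winning in terms of vectors in
    \<open>{1..n} \<rightarrow>\<^sub>E Q\<close>, the form in which \<open>W\<close> is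
    given.\<close>
  have prob: "measure_pmf.prob (question_dist ?R) {y. verdict ?R y (\<lambda>j\<in>{1..k}. f j (y j))} =
      card {x \<in> {1..n} \<rightarrow>\<^sub>E Q. ?win f x} / real (card Q) ^ n" for f
  proof -
    have "verdict ?R (to_players k n x) (\<lambda>j\<in>{1..k}. f j (to_players k n x j)) \<longleftrightarrow> ?win f x"
      if x: "x \<in> {1..n} \<rightarrow>\<^sub>E Q" for x
    proof -
      have x': "x \<in> {1..n} \<rightarrow>\<^sub>E PiE {1..k} X"
        using x assms(2) by (auto simp: PiE_iff)
      have "coord k (\<lambda>j\<in>{1..k}. f j (to_players k n x j)) i =
          (\<lambda>j\<in>{1..k}. f j (player_vec n x j) i)" for i
        by (auto simp: coord_def to_players_def fun_eq_iff)
      then show ?thesis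
        using coord_to_players[OF x'] by (simp add: repeated_game_def G_def)
    qed
    then have "{x \<in> {1..n} \<rightarrow>\<^sub>E Q. to_players k n x \<in> {y. verdict ?R y (\<lambda>j\<in>{1..k}. f j (y j))}} =
        {x \<in> {1..n} \<rightarrow>\<^sub>E Q. ?win f x}" by blast
    then show ?thesis
      by (subst prob_repeated_game_uniform[OF _ finQ assms(3)]) (simp_all add: G_def)
  qed
  have upper: "card {x \<in> {1..n} \<rightarrow>\<^sub>E Q. ?win f x} / real (card Q) ^ n \<le> extremal_density k Q n" for f
    by (intro extremal_density_upper[OF finQ]
        embedding_game_winning_set_not_forbidden[OF assms(4,2) W(2), of _ d f]) auto
  \<comment> \<open>The optimal strategy: at coordinate \<open>i\<close>, a player holding the
    vector \<open>v\<close> answers with the code of \<open>(i, v)\<close>.\<close>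
  define g where "g = (\<lambda>j\<in>{1..k}. \<lambda>v\<in>{1..n} \<rightarrow>\<^sub>E X j. \<lambda>i\<in>{1..n}.
      inv_into {0..<card (?B j)} (d j) (i, v))"
  have d_inv: "inv_into {0..<card (?B j)} (d j) b \<in> {0..<card (?B j)}"
      "d j (inv_into {0..<card (?B j)} (d j) b) = b"
    if "j \<in> {1..k}" "b \<in> ?B j" for j b
    using d[OF that(1)] that(2)
    by (auto simp: bij_betw_def simp del: atLeastLessThan_iff intro!: inv_into_into f_inv_into_f)
  have g: "g \<in> ?S"
    unfolding g_def using d_inv(1)
    by (auto simp: repeated_game_def G_def simp del: atLeastLessThan_iff intro!: restrict_PiE_iff[THEN iffD2])
  have "?win g x" if "x \<in> W" for x
  proof
    fix i assume i: "i \<in> {1..n}"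
    have x: "x \<in> {1..n} \<rightarrow>\<^sub>E PiE {1..k} X"
      using that W(1) PiE_mono[of "{1..n}" "\<lambda>_. Q" "\<lambda>_. PiE {1..k} X"] assms(2) by blast
    have "player_vec n x j \<in> {1..n} \<rightarrow>\<^sub>E X j" if "j \<in> {1..k}" for j
      using x that by (auto simp: player_vec_def PiE_iff)
    then have "d j (g j (player_vec n x j) i) = (i, player_vec n x j)" if "j \<in> {1..k}" for j
      using i that d_inv(2)[OF that] by (simp add: g_def)
    \<comment> \<open>The witness is \<open>x\<close> itself, which lies in \<open>W\<close> and has
      the entry \<open>x i\<close> at the named coordinate.\<close>
    then show "embedding_verdict k n W d (x i) (\<lambda>j\<in>{1..k}. g j (player_vec n x j) i)"
      unfolding embedding_verdict_def using i that by auto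
  qed
  then have "card W \<le> card {x \<in> {1..n} \<rightarrow>\<^sub>E Q. ?win g x}"
    using W(1) finQ by (intro card_mono) (auto simp: finite_PiE)
  then have lower: "extremal_density k Q n \<le> card {x \<in> {1..n} \<rightarrow>\<^sub>E Q. ?win g x} / real (card Q) ^ n"
    unfolding W(3) by (intro divide_right_mono) auto
  \<comment> \<open>Finiteness of the strategy set lets \<open>Max\<close> be identified by an upper
    bound that \<open>g\<close> attains.\<close>
  have "finite ?S"
    using is_game_repeated[OF game, of n] by (auto simp: is_game_def intro!: finite_PiE)
  then have "game_value k ?R = extremal_density k Q n"
    unfolding game_value_def prob
  proof (intro Max_eqI)
    show "extremal_density k Q n \<in> (\<lambda>f. card {x \<in> {1..n} \<rightarrow>\<^sub>E Q. ?win f x} / real (card Q) ^ n) ` ?S"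
      by (rule image_eqI[where x = g]) (intro antisym lower upper g)+
  qed (use upper in blast)+
  then show "\<exists>G :: ('x, nat) game. is_game k G \<and> questions G = X \<and> question_supp G = Q \<and>
    question_dist G = pmf_of_set Q \<and>
    card (PiE {1..k} (answers G)) = n ^ k * card (PiE {1..k} X) ^ n \<and>
    game_value k (repeated_game k n G) = extremal_density k Q n"
    using game card_answers by (intro exI[of _ G]) (simp add: G_def)
qed

end
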